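(* Let $n\ge 2$, let $(s_1,\dots,s_{n-1},p)\in\mathbb C^n$, and, when $|p|\neq 1$, let \[ Q=\left(\frac{s_1-\overline{s_{n-1}}p}{1-|p|^2},\frac{s_2-\overline{s_{n-2}}p}{1-|p|^2},\dots,\frac{s_{n-1}-\overline{s_1}p}{1-|p|^2}\right)\in\mathbb C^{n-1}. \] Then the following are equivalent (in (3), (4), (5) the requirement $Q\in\mathbb G_{n-1}$ includes $|p|\ne 1$): 1. $(s_1,\dots,s_{n-1},p)\in\mathbb G_n$; 2. $(\omega s_1,\omega^2s_2,\dots,\omega^{n-1}s_{n-1},\omega^np)\in\mathbb G_n$ for all $\omega\in\mathbb T$; 3. $\Phi_i(\alpha s_1,\dots,\alpha^{n-1}s_{n-1},\alpha^np)>0$ for all $\alpha\in\overline{\mathbb D}$ and $i=1,\dots,n-1$, and $Q\in\mathbb G_{n-1}$; 4. $\left|\binom{n}{i}\alpha^np-\alpha^{n-i}s_{n-i}\right|<\left|\binom{n}{i}-\alpha^is_i\right|$ for all $\alpha\in\overline{\mathbb D}$ and $i=1,\dots,n-1$, and $Q\in\mathbb G_{n-1}$; 5. $|s_i-\overline{s_{n-i}}p|+|s_{n-i}-\overline{s_i}p|<\binom{n}{i}(1-|p|^2)$ for $i=1,\dots,n-1$, and $Q\in\mathbb G_{n-1}$; 6. $|p|<1$ and there exists $(c_1,\dots,c_{n-1})\in\mathbb G_{n-1}$ such that $s_i=c_i+\overline{c_{n-i}}\,p$ for $i=1,\dots,n-1$.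
   Context: $\mathbb D$ is the open unit disc and $\mathbb T$ the unit circle in $\mathbb C$. For $m\ge1$, $\pi_m:\mathbb C^m\to\mathbb C^m$ is the symmetrization map $\pi_m(z)=\left(\sum_{i}z_i,\sum_{i<j}z_iz_j,\dots,\prod_i z_i\right)$ (elementary symmetric polynomials), and $\mathbb G_m=\pi_m(\mathbb D^m)$; in particular $\mathbb G_1=\mathbb D$. For scalars $(s_1,\dots,s_{n-1},p)\in\mathbb C^n$ and $1\le i\le n-1$, \[ \Phi_i(s_1,\dots,s_{n-1},p)=\binom{n}{i}^2(1-|p|^2)+(|s_i|^2-|s_{n-i}|^2)-\binom{n}{i}(s_i-\overline{s_{n-i}}p)-\binom{n}{i}(\overline{s_i}-\overline{p}s_{n-i}). \] *)

theory Defs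
  imports "HOL-Analysis.Analysis"
begin

text \<open>
  The dimensions \<open>n\<close> and \<open>n - 1\<close> occur in one statement, so a point of \<open>\<complex>\<^sup>m\<close> is a function
  \<open>nat \<Rightarrow> complex\<close> in \<open>extensional {1..m}\<close>: coordinates are numbered \<open>1, \<dots>, m\<close> as on paper,
  and outside of this range the function has the fixed value \<open>undefined\<close>, so that two
  points are equal iff their coordinates are.
\<close>

definition symmetrization :: "nat \<Rightarrow> (nat \<Rightarrow> complex) \<Rightarrow> (nat \<Rightarrow> complex)" where
  "symmetrization m z =
     (\<lambda>k\<in>{1..m}. \<Sum>I | I \<subseteq> {1..m} \<and> card I = k. \<Prod>i\<in>I. z i)"

definition symm_polydisc :: "nat \<Rightarrow> (nat \<Rightarrow> complex) set" where
  "symm_polydisc m = symmetrization m ` ({1..m} \<rightarrow>\<^sub>E ball 0 1)"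

text \<open>The point \<open>(s\<^sub>1, \<dots>, s\<^sub>n\<^sub>-\<^sub>1, p)\<close> of \<open>\<complex>\<^sup>n\<close>; only \<open>s 1, \<dots>, s (n - 1)\<close> are used.\<close>

definition point :: "nat \<Rightarrow> (nat \<Rightarrow> complex) \<Rightarrow> complex \<Rightarrow> (nat \<Rightarrow> complex)" where
  "point n s p = (\<lambda>i\<in>{1..n}. if i = n then p else s i)"

text \<open>
  The last two terms of the defining formula are complex conjugates of each other, so the
  formula has real values; \<open>Re\<close> only changes the type, as \<open>of_real_Phi\<close> confirms.
\<close>

definition Phi :: "nat \<Rightarrow> nat \<Rightarrow> (nat \<Rightarrow> complex) \<Rightarrow> complex \<Rightarrow> real" where
  "Phi n i s p = Re (
     of_nat (n choose i) ^ 2 * (1 - of_real (cmod p ^ 2))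
     + (of_real (cmod (s i) ^ 2) - of_real (cmod (s (n - i)) ^ 2))
     - of_nat (n choose i) * (s i - cnj (s (n - i)) * p)
     - of_nat (n choose i) * (cnj (s i) - cnj p * s (n - i)))"

lemma of_real_Phi:
  "of_real (Phi n i s p) =
     of_nat (n choose i) ^ 2 * (1 - of_real (cmod p ^ 2))
     + (of_real (cmod (s i) ^ 2) - of_real (cmod (s (n - i)) ^ 2))
     - of_nat (n choose i) * (s i - cnj (s (n - i)) * p)
     - of_nat (n choose i) * (cnj (s i) - cnj p * s (n - i))"
proof -
  have "Im (of_nat (n choose i) ^ 2 :: complex) = 0"
    by (metis Im_complex_of_real of_real_of_nat_eq of_nat_power)
  then show ?thesis
    by (simp add: Phi_def complex_eq_iff algebra_simps)
qed

text \<open>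
  The point \<open>Q\<close> of \<open>\<complex>\<^sup>n\<^sup>-\<^sup>1\<close>. Its definition makes sense only for \<open>cmod p \<noteq> 1\<close>; as \<open>x / 0 = 0\<close>,
  that condition has to be stated separately wherever \<open>Qpoint\<close> is used.
\<close>

definition Qpoint :: "nat \<Rightarrow> (nat \<Rightarrow> complex) \<Rightarrow> complex \<Rightarrow> (nat \<Rightarrow> complex)" where
  "Qpoint n s p =
     (\<lambda>i\<in>{1..n-1}. (s i - cnj (s (n - i)) * p) / of_real (1 - cmod p ^ 2))"

end

theory Submission
  imports Defs "HOL-Computational_Algebra.Fundamental_Theorem_Algebra"
begin

text \<open>
  A point \<open>(s\<^sub>1, \<dots>, s\<^sub>n\<^sub>-\<^sub>1, p)\<close> lies in the symmetrized polydisc iff the monic polynomial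
  \<open>P = x\<^sup>n - s\<^sub>1 x\<^sup>n\<^sup>-\<^sup>1 + \<dots> + (-1)\<^sup>n p\<close> has all its roots in the open unit disc. With \<open>P\<^sup>*\<close> the
  conjugate reversal of \<open>P\<close>, the polynomial \<open>(P - (-1)\<^sup>n p P\<^sup>*) / (1 - \<bar>p\<bar>\<^sup>2)\<close> is \<open>x\<close> times the monic
  polynomial belonging to \<open>Q\<close>: this is the Schur--Cohn reduction. As \<open>\<bar>P\<^sup>*\<bar> \<le> \<bar>P\<bar>\<close> outside the disc
  when the roots of \<open>P\<close> lie inside, adding a multiple of \<open>P\<^sup>*\<close> by a factor of modulus
  less than one creates no root outside, so the reduction can be read in both directions:
  the point is in \<open>G\<^sub>n\<close> iff \<open>\<bar>p\<bar> < 1\<close> and \<open>Q\<close> is in \<open>G\<^sub>n\<^sub>-\<^sub>1\<close>. The inequalities (5) are then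
  the coordinate bounds \<open>\<bar>Q\<^sub>i\<bar> < (n-1 choose i)\<close> added for \<open>i\<close> and \<open>n - i\<close>; they imply (3) by the
  triangle inequality, and each of (3), (4), (5) excludes \<open>\<bar>p\<bar> > 1\<close>.
\<close>

section \<open>Monic polynomials and elementary symmetric functions\<close>

definition sympoly :: "nat \<Rightarrow> (nat \<Rightarrow> complex) \<Rightarrow> complex \<Rightarrow> complex" where
  "sympoly n e x = (\<Sum>k\<le>n. (-1) ^ k * e k * x ^ (n - k))"

text \<open>The conjugate reversal \<open>x ^ n * cnj (sympoly n e (1 / cnj x))\<close>, written out
  so that it makes sense at \<open>x = 0\<close>.\<close>

definition revpoly :: "nat \<Rightarrow> (nat \<Rightarrow> complex) \<Rightarrow> complex \<Rightarrow> complex" where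
  "revpoly n e x = (\<Sum>k\<le>n. (-1) ^ k * cnj (e k) * x ^ k)"

text \<open>
  The zeros beyond \<open>n\<close> let the same coefficients be read in degree \<open>n + 1\<close>, which multiplies
  the polynomial by \<open>x\<close>.
\<close>

definition monic_coeffs :: "nat \<Rightarrow> (nat \<Rightarrow> complex) \<Rightarrow> nat \<Rightarrow> complex" where
  "monic_coeffs n c = (\<lambda>k. if k = 0 then 1 else if k \<le> n then c k else 0)"

lemma monic_coeffs_0 [simp]: "monic_coeffs n c 0 = 1"
  by (simp add: monic_coeffs_def)

text \<open>Vieta's formulas: expand the product over subsets of the roots and group them by
  cardinality.\<close>

lemma sympoly_symmetrization:
  "sympoly m (monic_coeffs m (symmetrization m z)) x = (\<Prod>i\<in>{1..m}. x - z i)"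
proof -
  have "(\<Prod>i\<in>{1..m}. x - z i)
      = (\<Sum>I\<in>Pow {1..m}. (-1) ^ card I * prod z I * (\<Prod>i\<in>{1..m} - I. x))"
    by (rule prod_diff_conv_sum) simp
  also have "\<dots> = (\<Sum>I\<in>Pow {1..m}. (-1) ^ card I * prod z I * x ^ (m - card I))"
    by (intro sum.cong) (auto simp: card_Diff_subset finite_subset)
  also have "\<dots> = (\<Sum>k\<le>m. \<Sum>I\<in>{I. I \<in> Pow {1..m} \<and> card I = k}.
                    (-1) ^ card I * prod z I * x ^ (m - card I))"
    by (rule sum.group [symmetric])
       (use card_mono[of "{1..m}"] in fastforce)+
  also have "\<dots> = (\<Sum>k\<le>m. (-1) ^ k * monic_coeffs m (symmetrization m z) k * x ^ (m - k))"
  proof (rule sum.cong [OF refl])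
    fix k assume k: "k \<in> {..m}"
    have "monic_coeffs m (symmetrization m z) k = (\<Sum>I | I \<subseteq> {1..m} \<and> card I = k. prod z I)"
    \<comment> \<open>\<open>symmetrization\<close> has no coordinate 0; the 1 in
      \<open>monic_coeffs\<close> is the product over the empty set.\<close>
    proof (cases "k = 0")
      case True
      have "{I. I \<subseteq> {1..m} \<and> card I = 0} = {{}}"
        by (auto dest: finite_subset)
      then show ?thesis
        using True by (simp add: monic_coeffs_def)
    qed (use k in \<open>simp add: monic_coeffs_def symmetrization_def\<close>)
    then show "(\<Sum>I\<in>{I. I \<in> Pow {1..m} \<and> card I = k}. (-1) ^ card I * prod z I * x ^ (m - card I))
        = (-1) ^ k * monic_coeffs m (symmetrization m z) k * x ^ (m - k)"
      by (simp add: sum_distrib_left sum_distrib_right)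
  qed
  finally show ?thesis
    by (simp add: sympoly_def)
qed

text \<open>The fundamental theorem of algebra; \<open>e 0 = 1\<close> makes the degree exactly
  \<open>n\<close>.\<close>

lemma sympoly_factorization:
  assumes "e 0 = 1"
  obtains z where "\<And>x. sympoly n e x = (\<Prod>i\<in>{1..n}. x - z i)"
proof -
  define P where "P = (\<Sum>k\<le>n. monom ((-1) ^ k * e k) (n - k))"
  have P: "poly P x = sympoly n e x" for x
    by (simp add: P_def sympoly_def poly_sum poly_monom)
  have "coeff P n = (\<Sum>k\<le>n. if k = 0 then 1 else 0)"
    unfolding P_def coeff_sum by (intro sum.cong) (use assms in auto)
  then have lc: "coeff P n = 1"
    by simp
  have deg: "degree P = n"
  proof (rule antisym)
    show "degree P \<le> n"
      unfolding P_def by (intro degree_sum_le) (auto intro: order_trans[OF degree_monom_le])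
    show "n \<le> degree P"
      using lc by (intro le_degree) simp
  qed
  have "P \<noteq> 0"
    using lc by auto
  from alg_closed_imp_factorization[OF this] obtain A
    where A: "size A = n" "P = (\<Prod>x\<in>#A. [:-x, 1:])"
    using deg lc by auto
  obtain xs where xs: "mset xs = A"
    using ex_mset by blast
  have len: "length xs = n"
    using A xs by auto
  show thesis
  proof
    fix x
    have "sympoly n e x = (\<Prod>a\<leftarrow>xs. x - a)"
      unfolding P[symmetric] A(2) xs[symmetric]
      by (induction xs) (auto simp: algebra_simps)
    also have "\<dots> = (\<Prod>i = 0..<n. x - xs ! i)"
      by (simp add: prod.list_conv_set_nth len)
    also have "\<dots> = (\<Prod>i\<in>{1..n}. x - xs ! (i - 1))"
      by (rule prod.reindex_bij_witness[of _ "\<lambda>i. i - 1" Suc]) auto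
    finally show "sympoly n e x = (\<Prod>i\<in>{1..n}. x - xs ! (i - 1))" .
  qed
qed

lemma sympoly_eq_imp_eq:
  assumes "\<And>x. sympoly n e x = sympoly n e' x" "k \<le> n"
  shows "e k = e' k"
proof -
  have rev: "sympoly n f x = (\<Sum>k\<le>n. (-1) ^ (n - k) * f (n - k) * x ^ k)" for f x
    unfolding sympoly_def
    by (rule sum.reindex_bij_witness[of _ "\<lambda>i. n - i" "\<lambda>i. n - i"]) auto
  have "\<forall>k\<le>n. (-1) ^ (n - k) * e (n - k) = (-1) ^ (n - k) * e' (n - k)"
    using assms(1) polyfun_eq_coeffs[of "\<lambda>k. (-1) ^ (n - k) * e (n - k)" n
        "\<lambda>k. (-1) ^ (n - k) * e' (n - k)"] unfolding rev by blast
  from this[rule_format, of "n - k"] show ?thesis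
    using assms(2) by simp
qed

text \<open>Vieta's formulas give one direction. Conversely the roots, listed with multiplicity, are
  a preimage of \<open>c\<close>, because a polynomial function determines its coefficients.\<close>

lemma symm_polydisc_iff:
  assumes "c \<in> extensional {1..m}"
  shows "c \<in> symm_polydisc m \<longleftrightarrow> (\<forall>x. sympoly m (monic_coeffs m c) x = 0 \<longrightarrow> cmod x < 1)"
proof
  assume "c \<in> symm_polydisc m"
  then obtain z where z: "z \<in> {1..m} \<rightarrow>\<^sub>E ball 0 1" "c = symmetrization m z"
    by (auto simp: symm_polydisc_def)
  show "\<forall>x. sympoly m (monic_coeffs m c) x = 0 \<longrightarrow> cmod x < 1"
    unfolding z(2) sympoly_symmetrization using z(1) by (auto simp: PiE_iff)
next
  assume R: "\<forall>x. sympoly m (monic_coeffs m c) x = 0 \<longrightarrow> cmod x < 1"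
  obtain w where w: "\<And>x. sympoly m (monic_coeffs m c) x = (\<Prod>i\<in>{1..m}. x - w i)"
    using sympoly_factorization[of "monic_coeffs m c" m] by auto
  define z where "z = restrict w {1..m}"
  have "sympoly m (monic_coeffs m (symmetrization m z)) x = sympoly m (monic_coeffs m c) x" for x
    unfolding sympoly_symmetrization w by (intro prod.cong) (auto simp: z_def)
  then have eq: "monic_coeffs m (symmetrization m z) k = monic_coeffs m c k" if "k \<le> m" for k
    using sympoly_eq_imp_eq that by blast
  have "symmetrization m z = c"
  proof (rule extensionalityI)
    show "symmetrization m z \<in> extensional {1..m}"
      by (simp add: symmetrization_def)
    show "symmetrization m z k = c k" if "k \<in> {1..m}" for k
      using eq[of k] that by (simp add: monic_coeffs_def)
  qed fact
  moreover have "z \<in> {1..m} \<rightarrow>\<^sub>E ball 0 1"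
  proof -
    have "sympoly m (monic_coeffs m c) (w i) = 0" if "i \<in> {1..m}" for i
      unfolding w using that by auto
    then show ?thesis
      using R by (auto simp: z_def)
  qed
  ultimately show "c \<in> symm_polydisc m"
    unfolding symm_polydisc_def by blast
qed

section \<open>Coordinate bounds and scaling in the symmetrized polydisc\<close>

text \<open>There are \<open>m choose k\<close> summands, each a nonempty product of factors of
  modulus below 1.\<close>

lemma symm_polydisc_coord_less:
  assumes "c \<in> symm_polydisc m" "k \<in> {1..m}"
  shows "cmod (c k) < real (m choose k)"
proof -
  from assms(1) obtain z where z: "z \<in> {1..m} \<rightarrow>\<^sub>E ball 0 1" "c = symmetrization m z"
    by (auto simp: symm_polydisc_def)
  let ?K = "{I. I \<subseteq> {1..m} \<and> card I = k}"
  have fin: "finite ?K"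
    by (rule finite_subset[of _ "Pow {1..m}"]) auto
  have card: "card ?K = m choose k"
    using n_subsets[of "{1..m}" k] by simp
  have "cmod (c k) \<le> (\<Sum>I\<in>?K. \<Prod>i\<in>I. cmod (z i))"
    using assms(2) by (auto simp: z(2) symmetrization_def prod_norm intro: sum_norm_le)
  also have "\<dots> < (\<Sum>I\<in>?K. 1)"
  proof (rule sum_strict_mono[OF fin])
    have "card ?K > 0"
      unfolding card using assms(2) by (simp add: zero_less_binomial_iff)
    then show "?K \<noteq> {}"
      using card_gt_0_iff by blast
    fix I assume I: "I \<in> ?K"
    then have "I \<noteq> {}"
      using assms(2) by auto
    then obtain i where "i \<in> I"
      by blast
    moreover have "cmod (z j) < 1" if "j \<in> I" for j
      using I that z(1) by (auto simp: PiE_iff)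
    moreover have "finite I"
      using I finite_subset by blast
    ultimately show "(\<Prod>i\<in>I. cmod (z i)) < 1"
      using prod_mono_strict[of i I "\<lambda>i. cmod (z i)" "\<lambda>_. 1"] by (simp add: less_imp_le)
  qed
  also have "\<dots> = real (m choose k)"
    using card by simp
  finally show ?thesis .
qed

lemma symm_polydisc_last_less:
  assumes "c \<in> symm_polydisc m" "m \<ge> 1"
  shows "cmod (c m) < 1"
  using symm_polydisc_coord_less[OF assms(1), of m] assms(2) by simp

text \<open>Scale the roots by \<open>a\<close>: the elementary symmetric polynomial of degree
  \<open>k\<close> is homogeneous.\<close>

lemma symm_polydisc_scale:
  assumes "c \<in> symm_polydisc m" "cmod a \<le> 1"
  shows "(\<lambda>k\<in>{1..m}. a ^ k * c k) \<in> symm_polydisc m"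
proof -
  from assms(1) obtain z where z: "z \<in> {1..m} \<rightarrow>\<^sub>E ball 0 1" "c = symmetrization m z"
    by (auto simp: symm_polydisc_def)
  have "(\<lambda>k\<in>{1..m}. a ^ k * c k) = symmetrization m (\<lambda>i\<in>{1..m}. a * z i)"
    unfolding z(2) symmetrization_def
  proof (rule restrict_ext)
    fix k assume k: "k \<in> {1..m}"
    have "(\<Prod>i\<in>I. restrict (\<lambda>i. a * z i) {1..m} i) = a ^ k * prod z I"
      if "I \<subseteq> {1..m}" "card I = k" for I
    proof -
      have "(\<Prod>i\<in>I. restrict (\<lambda>i. a * z i) {1..m} i) = (\<Prod>i\<in>I. a * z i)"
        using that by (intro prod.cong) auto
      then show ?thesis
        using that by (simp add: prod.distrib)
    qed
    then show "a ^ k * restrict (\<lambda>k. \<Sum>I | I \<subseteq> {1..m} \<and> card I = k. prod z I) {1..m} k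
        = (\<Sum>I | I \<subseteq> {1..m} \<and> card I = k. \<Prod>i\<in>I. restrict (\<lambda>i. a * z i) {1..m} i)"
      using k by (simp add: sum_distrib_left)
  qed
  moreover have "(\<lambda>i\<in>{1..m}. a * z i) \<in> {1..m} \<rightarrow>\<^sub>E ball 0 1"
  proof -
    have "cmod (a * z i) < 1" if "i \<in> {1..m}" for i
    proof -
      have "cmod (a * z i) \<le> cmod (z i)"
        using assms(2) by (simp add: norm_mult mult_left_le_one_le)
      also have "\<dots> < 1"
        using z(1) that by (auto simp: PiE_iff)
      finally show ?thesis .
    qed
    then show ?thesis
      by auto
  qed
  ultimately show ?thesis
    unfolding symm_polydisc_def by blast
qed

section \<open>Conjugate reversal outside the open disc\<close>

lemma revpoly_eq:
  assumes "x \<noteq> 0"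
  shows "revpoly n e x = x ^ n * cnj (sympoly n e (1 / cnj x))"
  unfolding revpoly_def sympoly_def cnj_sum sum_distrib_left
proof (rule sum.cong [OF refl])
  fix k assume "k \<in> {..n}"
  then have "x ^ n = x ^ k * x ^ (n - k)"
    by (simp flip: power_add)
  then show "(-1) ^ k * cnj (e k) * x ^ k = x ^ n * cnj ((-1) ^ k * e k * (1 / cnj x) ^ (n - k))"
    using assms by (simp add: power_one_over)
qed

text \<open>The Blaschke factor estimate: the difference of squares factors into nonnegative
  terms.\<close>

lemma norm_one_minus_cnj_mult_le:
  assumes "cmod a < 1" "cmod x \<ge> 1"
  shows "cmod (1 - cnj a * x) \<le> cmod (x - a)"
proof -
  have "(cmod (x - a))\<^sup>2 - (cmod (1 - cnj a * x))\<^sup>2 = ((cmod x)\<^sup>2 - 1) * (1 - (cmod a)\<^sup>2)"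
    unfolding cmod_power2 by (simp add: power2_eq_square algebra_simps)
  moreover have "\<dots> \<ge> 0"
    using assms by (intro mult_nonneg_nonneg) (simp_all add: power_le_one)
  ultimately show ?thesis
    by (intro power2_le_imp_le[OF _ norm_ge_zero]) linarith
qed

text \<open>The reversal is the product of the factors \<open>1 - cnj (z i) * x\<close>, each
  dominated by \<open>x - z i\<close>.\<close>

lemma norm_revpoly_le:
  assumes "e 0 = 1" "\<And>y. sympoly n e y = 0 \<Longrightarrow> cmod y < 1" "cmod x \<ge> 1"
  shows "cmod (revpoly n e x) \<le> cmod (sympoly n e x)"
proof -
  obtain z where z: "\<And>x. sympoly n e x = (\<Prod>i\<in>{1..n}. x - z i)"
    using sympoly_factorization assms(1) by blast
  have x: "x \<noteq> 0"
    using assms(3) by auto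
  have "revpoly n e x = (\<Prod>i\<in>{1..n}. x * cnj (1 / cnj x - z i))"
    unfolding revpoly_eq[OF x] z by (simp add: prod.distrib)
  also have "\<dots> = (\<Prod>i\<in>{1..n}. 1 - cnj (z i) * x)"
    using x by (intro prod.cong) (auto simp: field_simps)
  finally have "cmod (revpoly n e x) = (\<Prod>i\<in>{1..n}. cmod (1 - cnj (z i) * x))"
    by (simp add: prod_norm)
  also have "\<dots> \<le> (\<Prod>i\<in>{1..n}. cmod (x - z i))"
  proof (intro prod_mono conjI)
    fix i assume i: "i \<in> {1..n}"
    have "sympoly n e (z i) = 0"
      unfolding z using i by auto
    then show "cmod (1 - cnj (z i) * x) \<le> cmod (x - z i)"
      using assms(2,3) by (intro norm_one_minus_cnj_mult_le) auto
  qed auto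
  also have "\<dots> = cmod (sympoly n e x)"
    by (simp add: z prod_norm)
  finally show ?thesis .
qed

text \<open>At a zero both summands have equal modulus, but the second is at most
  \<open>cmod w < 1\<close> times the first, which is nonzero.\<close>

lemma sympoly_add_revpoly_nonzero:
  assumes "e 0 = 1" "\<And>y. sympoly n e y = 0 \<Longrightarrow> cmod y < 1" "cmod x \<ge> 1" "cmod w < 1"
  shows "sympoly n e x + w * revpoly n e x \<noteq> 0"
proof
  assume "sympoly n e x + w * revpoly n e x = 0"
  then have "cmod (sympoly n e x) = cmod w * cmod (revpoly n e x)"
    by (metis add_eq_0_iff norm_minus_cancel norm_mult)
  also have "\<dots> \<le> cmod w * cmod (sympoly n e x)"
    by (intro mult_left_mono norm_revpoly_le assms) auto
  finally have "(1 - cmod w) * cmod (sympoly n e x) \<le> 0"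
    by (simp add: algebra_simps)
  moreover have "sympoly n e x \<noteq> 0"
    using assms(2)[of x] assms(3) by auto
  ultimately show False
    using assms(4) by (simp add: mult_le_0_iff)
qed

text \<open>Replacing \<open>k\<close> by \<open>n - k\<close> costs the sign
  \<open>(-1) ^ n\<close>. The reduction uses \<open>w = p\<close> in one direction and
  \<open>w = - p\<close> in the other.\<close>

lemma sympoly_reverse:
  "sympoly n (\<lambda>k. e k + cnj (e (n - k)) * w) x = sympoly n e x + (-1) ^ n * w * revpoly n e x"
proof -
  have "revpoly n e x = (\<Sum>k\<le>n. (-1) ^ (n - k) * cnj (e (n - k)) * x ^ (n - k))"
    unfolding revpoly_def
    by (rule sum.reindex_bij_witness[of _ "\<lambda>i. n - i" "\<lambda>i. n - i"]) auto
  then have "(-1) ^ n * w * revpoly n e x = (\<Sum>k\<le>n. (-1) ^ k * (cnj (e (n - k)) * w) * x ^ (n - k))"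
    by (simp only: sum_distrib_left, intro sum.cong refl)
       (auto simp: minus_one_power_iff even_diff_nat)
  then show ?thesis
    by (simp add: sympoly_def algebra_simps sum.distrib)
qed

lemma sympoly_cong:
  assumes "\<And>k. k \<le> n \<Longrightarrow> e k = e' k"
  shows "sympoly n e x = sympoly n e' x"
  unfolding sympoly_def by (intro sum.cong refl) (use assms in auto)

lemma sympoly_monic_coeffs_Suc:
  "sympoly (Suc m) (monic_coeffs m c) x = x * sympoly m (monic_coeffs m c) x"
  unfolding sympoly_def sum_distrib_left
  by (simp add: monic_coeffs_def, intro sum.cong refl) (simp add: Suc_diff_le)

lemma sympoly_mult: "sympoly n (\<lambda>k. d * e k) x = d * sympoly n e x"
  unfolding sympoly_def sum_distrib_left by (simp add: algebra_simps)

section \<open>The Schur-Cohn reduction\<close>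

text \<open>Multiplying the polynomial of \<open>c\<close> by \<open>x\<close> keeps the roots in
  the disc; adding a small multiple of the reversal then gives the polynomial of the point.\<close>

lemma point_symm_polydisc_of_decomposition:
  assumes n: "n \<ge> 2" and p: "cmod p < 1" and c: "c \<in> symm_polydisc (n - 1)"
    and s: "\<And>i. i \<in> {1..n-1} \<Longrightarrow> s i = c i + cnj (c (n - i)) * p"
  shows "point n s p \<in> symm_polydisc n"
proof -
  define e where "e = monic_coeffs (n - 1) c"
  have cext: "c \<in> extensional {1..n-1}"
    using c by (auto simp: symm_polydisc_def symmetrization_def)
  have e: "sympoly n e x = x * sympoly (n - 1) e x" for x
    using sympoly_monic_coeffs_Suc[of "n - 1" c x] n by (simp add: e_def)
  have zeros: "cmod y < 1" if "sympoly n e y = 0" for y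
    using that c symm_polydisc_iff[OF cext] unfolding e by (auto simp: e_def)
  \<comment> \<open>The padding \<open>e n = 0\<close> settles the ends: \<open>k = 0\<close> gives
    1 and \<open>k = n\<close> gives \<open>p\<close>.\<close>
  have coeffs: "monic_coeffs n (point n s p) k = e k + cnj (e (n - k)) * p" if k: "k \<le> n" for k
  proof -
    consider "k = 0" | "k = n" "k > 0" | "k \<in> {1..n-1}"
      using k by force
    then show ?thesis
    proof cases
      case 3
      moreover from 3 have "n - k \<in> {1..n-1}" "k < n"
        by auto
      ultimately show ?thesis
        by (auto simp: e_def monic_coeffs_def point_def s)
    qed (use n in \<open>auto simp: e_def monic_coeffs_def point_def\<close>)
  qed
  have eq: "sympoly n (monic_coeffs n (point n s p)) x = sympoly n e x + (-1) ^ n * p * revpoly n e x" for x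
    unfolding sympoly_reverse[symmetric] using coeffs by (rule sympoly_cong)
  have "sympoly n (monic_coeffs n (point n s p)) x \<noteq> 0" if "cmod x \<ge> 1" for x
    unfolding eq using zeros that p
    by (intro sympoly_add_revpoly_nonzero) (auto simp: e_def norm_mult norm_power)
  then show ?thesis
    by (subst symm_polydisc_iff) (force simp: point_def not_less)+
qed

lemma one_minus_norm_square:
  "1 - complex_of_real (cmod p ^ 2) = 1 - cnj p * p"
  by (simp only: complex_norm_square mult.commute)

lemma one_minus_norm_square_nonzero:
  assumes "cmod p < 1"
  shows "1 - complex_of_real (cmod p ^ 2) \<noteq> 0"
proof -
  have "1 - (cmod p)\<^sup>2 \<noteq> 0"
    using assms by (simp add: power2_eq_1_iff) (use norm_ge_zero[of p] in linarith)
  then show ?thesis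
    by (metis of_real_1 of_real_diff of_real_eq_0_iff)
qed

lemma Qpoint_mem:
  assumes n: "n \<ge> 2" and mem: "point n s p \<in> symm_polydisc n"
  shows "cmod p < 1" "Qpoint n s p \<in> symm_polydisc (n - 1)"
proof -
  show p: "cmod p < 1"
    using symm_polydisc_last_less[OF mem] n by (simp add: point_def)
  define d where "d = (1 - of_real (cmod p ^ 2) :: complex)"
  have dp: "d = 1 - cnj p * p"
    unfolding d_def by (rule one_minus_norm_square)
  have d: "d \<noteq> 0"
    unfolding d_def using p by (rule one_minus_norm_square_nonzero)
  define e where "e = monic_coeffs n (point n s p)"
  define q where "q = monic_coeffs (n - 1) (Qpoint n s p)"
  have zeros: "cmod y < 1" if "sympoly n e y = 0" for y
    using mem that by (subst (asm) symm_polydisc_iff) (auto simp: point_def e_def)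
  \<comment> \<open>At \<open>k = 0\<close> this is \<open>d = 1 - cnj p * p\<close>; at
    \<open>k = n\<close> the constant term cancels, so a factor \<open>x\<close> splits off.\<close>
  have coeffs: "d * q k = e k + cnj (e (n - k)) * (- p)" if k: "k \<le> n" for k
  proof -
    consider "k = 0" | "k = n" "k > 0" | "k \<in> {1..n-1}"
      using k by force
    then show ?thesis
    proof cases
      case 3
      moreover from 3 have "n - k \<in> {1..n-1}" "k < n"
        by auto
      ultimately show ?thesis
        using d by (auto simp: q_def e_def monic_coeffs_def point_def Qpoint_def d_def)
    qed (use n in \<open>auto simp: q_def e_def monic_coeffs_def point_def dp\<close>)
  qed
  have eq: "d * (x * sympoly (n - 1) q x) = sympoly n e x + (-1) ^ n * (- p) * revpoly n e x" for x
  proof -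
    have "d * (x * sympoly (n - 1) q x) = sympoly n (\<lambda>k. d * q k) x"
      using sympoly_monic_coeffs_Suc[of "n - 1" "Qpoint n s p" x] n by (simp add: q_def sympoly_mult)
    also have "\<dots> = sympoly n (\<lambda>k. e k + cnj (e (n - k)) * (- p)) x"
      using coeffs by (rule sympoly_cong)
    finally show ?thesis
      by (simp only: sympoly_reverse)
  qed
  have "d * (x * sympoly (n - 1) q x) \<noteq> 0" if "cmod x \<ge> 1" for x
    unfolding eq using zeros that p
    by (intro sympoly_add_revpoly_nonzero) (auto simp: e_def norm_mult norm_power)
  then have "sympoly (n - 1) q x \<noteq> 0" if "cmod x \<ge> 1" for x
    using that by fastforce
  then show "Qpoint n s p \<in> symm_polydisc (n - 1)"
    by (subst symm_polydisc_iff) (force simp: Qpoint_def q_def not_less)+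
qed

text \<open>\<open>Qpoint\<close> solves the linear system formed by the equation for
  \<open>i\<close> and the conjugated one for \<open>n - i\<close>, whose determinant is
  \<open>1 - cnj p * p\<close>.\<close>

lemma Qpoint_decomposition:
  assumes "cmod p < 1" "i \<in> {1..n-1}"
  shows "s i = Qpoint n s p i + cnj (Qpoint n s p (n - i)) * p"
proof -
  define d where "d = (1 - of_real (cmod p ^ 2) :: complex)"
  have dp: "d = 1 - cnj p * p"
    unfolding d_def by (rule one_minus_norm_square)
  have cd: "cnj d = d"
    by (simp add: d_def)
  have d: "d \<noteq> 0"
    unfolding d_def using assms(1) by (rule one_minus_norm_square_nonzero)
  have "n - i \<in> {1..n-1}" "n - (n - i) = i"
    using assms by auto
  then have "Qpoint n s p i = (s i - cnj (s (n - i)) * p) / d"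
    "Qpoint n s p (n - i) = (s (n - i) - cnj (s i) * p) / d"
    using assms(2) by (simp_all add: Qpoint_def d_def)
  then have "Qpoint n s p i + cnj (Qpoint n s p (n - i)) * p
      = (s i - cnj (s (n - i)) * p + (cnj (s (n - i)) - s i * cnj p) * p) / d"
    by (simp add: cd add_divide_distrib)
  also have "\<dots> = s i * d / d"
    by (simp add: dp algebra_simps)
  finally show ?thesis
    using d by simp
qed

lemma point_mem_iff_Qpoint:
  assumes "n \<ge> 2"
  shows "point n s p \<in> symm_polydisc n \<longleftrightarrow> cmod p < 1 \<and> Qpoint n s p \<in> symm_polydisc (n - 1)"
  using Qpoint_mem[OF assms] Qpoint_decomposition
    point_symm_polydisc_of_decomposition[OF assms, of p "Qpoint n s p" s] by blast

section \<open>Positivity of \<open>Phi\<close> as a comparison of moduli\<close>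

lemma Phi_eq_norm_diff:
  "Phi n i s p = (cmod (of_nat (n choose i) - s i))\<^sup>2 - (cmod (of_nat (n choose i) * p - s (n - i)))\<^sup>2"
proof -
  have "(of_nat (n choose i) ^ 2 :: complex) = of_real (real (n choose i) ^ 2)"
    by simp
  then show ?thesis
    unfolding Phi_def cmod_power2
    by (simp del: of_real_power of_nat_power add: power2_eq_square algebra_simps)
qed

lemma norm_power2_less_iff: "(norm a)\<^sup>2 < (norm b)\<^sup>2 \<longleftrightarrow> norm a < norm b"
  unfolding not_le[symmetric] by (simp add: power_mono_iff)

lemma Phi_pos_iff:
  "Phi n i s p > 0 \<longleftrightarrow>
     cmod (of_nat (n choose i) * p - s (n - i)) < cmod (of_nat (n choose i) - s i)"
  unfolding Phi_eq_norm_diff by (simp add: norm_power2_less_iff)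

text \<open>For the two differences \<open>A = s i - cnj (s (n - i)) * p\<close> and
  \<open>B = s (n - i) - cnj (s i) * p\<close>, the squared moduli differ by
  \<open>1 - (cmod p)\<^sup>2\<close> times those of \<open>s i\<close> and
  \<open>s (n - i)\<close>. No sign of that factor is fixed, so both \<open>cmod p < 1\<close> and
  \<open>cmod p > 1\<close> are covered.\<close>

lemma mult_Phi_eq:
  "(1 - (cmod p)\<^sup>2) * Phi n i s p =
     (cmod (of_real (real (n choose i) * (1 - (cmod p)\<^sup>2)) - (s i - cnj (s (n - i)) * p)))\<^sup>2
     - (cmod (s (n - i) - cnj (s i) * p))\<^sup>2"
  unfolding Phi_eq_norm_diff cmod_power2
  by (simp add: power2_eq_square algebra_simps)

text \<open>The triangle inequality makes the right side of \<open>mult_Phi_eq\<close>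
  positive.\<close>

lemma Phi_pos_of_norm_sum_less:
  assumes p: "cmod p < 1"
    and less: "cmod (s i - cnj (s (n - i)) * p) + cmod (s (n - i) - cnj (s i) * p)
      < real (n choose i) * (1 - (cmod p)\<^sup>2)"
  shows "Phi n i s p > 0"
proof -
  let ?D = "of_real (real (n choose i) * (1 - (cmod p)\<^sup>2)) :: complex"
  let ?A = "s i - cnj (s (n - i)) * p" and ?B = "s (n - i) - cnj (s i) * p"
  have "real (n choose i) * (1 - (cmod p)\<^sup>2) \<le> cmod ?D"
    by (simp only: norm_of_real abs_ge_self)
  then have "cmod ?B < cmod (?D - ?A)"
    using less norm_triangle_ineq2[of ?D ?A] by linarith
  then have "(cmod ?B)\<^sup>2 < (cmod (?D - ?A))\<^sup>2"
    by (simp add: power_strict_mono)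
  then have "(1 - (cmod p)\<^sup>2) * Phi n i s p > 0"
    unfolding mult_Phi_eq by linarith
  moreover have "1 - (cmod p)\<^sup>2 > 0"
    using p by (simp add: abs_square_less_1)
  ultimately show ?thesis
    by (simp add: zero_less_mult_iff)
qed

text \<open>For \<open>cmod p > 1\<close> the factor in \<open>mult_Phi_eq\<close> is negative and
  reverses the comparison.\<close>

lemma norm_less_of_Phi_pos:
  assumes p: "cmod p > 1" and pos: "Phi n i s p > 0"
  shows "cmod (of_real (real (n choose i) * (1 - (cmod p)\<^sup>2)) - (s i - cnj (s (n - i)) * p))
    < cmod (s (n - i) - cnj (s i) * p)"
proof -
  have "1 - (cmod p)\<^sup>2 < 0"
    using p by simp
  then have "(1 - (cmod p)\<^sup>2) * Phi n i s p < 0"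
    using pos by (simp add: mult_less_0_iff)
  then show ?thesis
    unfolding mult_Phi_eq by (simp add: norm_power2_less_iff del: of_real_mult)
qed

text \<open>
  With \<open>D\<close>, \<open>A\<close>, \<open>B\<close> as in the proof and \<open>\<bar>p\<bar> > 1\<close>, rotating so that \<open>\<alpha> A = \<bar>A\<bar>\<close> turns \<open>\<Phi>\<^sub>1 > 0\<close> into \<open>D + \<bar>A\<bar> < \<bar>B\<bar>\<close>, whereas
  \<open>\<Phi>\<^sub>n\<^sub>-\<^sub>1 > 0\<close> at \<open>\<alpha> = 1\<close> gives \<open>\<bar>B\<bar> - D < \<bar>A\<bar>\<close>.
\<close>

lemma norm_less_one_of_Phi_pos:
  assumes n: "n \<ge> 2" and p1: "cmod p \<noteq> 1"
    and pos: "\<And>\<alpha> i. cmod \<alpha> \<le> 1 \<Longrightarrow> i \<in> {1..n-1} \<Longrightarrow> Phi n i (\<lambda>j. \<alpha> ^ j * s j) (\<alpha> ^ n * p) > 0"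
  shows "cmod p < 1"
proof (rule ccontr)
  assume "\<not> cmod p < 1"
  then have p: "cmod p > 1"
    using p1 by simp
  define D where "D = real n * ((cmod p)\<^sup>2 - 1)"
  define A where "A = s 1 - cnj (s (n - 1)) * p"
  define B where "B = s (n - 1) - cnj (s 1) * p"
  obtain \<alpha> where \<alpha>: "cmod \<alpha> = 1" "\<alpha> * A = of_real (cmod A)"
  proof (cases "A = 0")
    case True
    then show thesis
      using that[of 1] by simp
  next
    case False
    show thesis
    proof (rule that)
      show "cmod (cnj A / of_real (cmod A)) = 1"
        using False by (simp add: norm_divide)
      have "cnj A * A = of_real (cmod A) * of_real (cmod A)"
        using complex_norm_square[of A] by (simp add: power2_eq_square mult.commute)
      then show "cnj A / of_real (cmod A) * A = of_real (cmod A)"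
        using False by simp
    qed
  qed
  have \<alpha>\<alpha>: "cnj \<alpha> * \<alpha> = 1"
    using \<alpha>(1) complex_norm_square[of \<alpha>] by (simp add: mult.commute)
  have \<alpha>n: "\<alpha> ^ n = \<alpha> * \<alpha> ^ (n - 1)"
    using n by (simp flip: power_Suc)
  have \<alpha>\<alpha>n: "cnj \<alpha> ^ (n - 1) * \<alpha> ^ (n - 1) = 1"
    using \<alpha>\<alpha> by (simp flip: power_mult_distrib)
  have normp: "cmod (\<alpha> ^ n * p) = cmod p"
    using \<alpha>(1) by (simp add: norm_mult norm_power)
  have A\<alpha>: "\<alpha> ^ 1 * s 1 - cnj (\<alpha> ^ (n - 1) * s (n - 1)) * (\<alpha> ^ n * p) = \<alpha> * A"
  proof -
    have eq: "cnj (\<alpha> ^ (n - 1) * s (n - 1)) * (\<alpha> ^ n * p)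
        = (cnj \<alpha> ^ (n - 1) * \<alpha> ^ (n - 1)) * (\<alpha> * (cnj (s (n - 1)) * p))"
      unfolding \<alpha>n by simp
    show ?thesis
      by (simp only: eq \<alpha>\<alpha>n) (simp add: A_def algebra_simps)
  qed
  have B\<alpha>: "\<alpha> ^ (n - 1) * s (n - 1) - cnj (\<alpha> ^ 1 * s 1) * (\<alpha> ^ n * p) = \<alpha> ^ (n - 1) * B"
  proof -
    have eq: "cnj (\<alpha> ^ 1 * s 1) * (\<alpha> ^ n * p) = (cnj \<alpha> * \<alpha>) * (\<alpha> ^ (n - 1) * (cnj (s 1) * p))"
      unfolding \<alpha>n by simp
    show ?thesis
      by (simp only: eq \<alpha>\<alpha>) (simp add: B_def algebra_simps)
  qed
  have "cmod (of_real (- D) - \<alpha> * A) < cmod (\<alpha> ^ (n - 1) * B)"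
    using norm_less_of_Phi_pos[OF _ pos[of \<alpha> 1]] p \<alpha>(1) n
    unfolding normp A\<alpha> B\<alpha> by (simp add: D_def algebra_simps)
  moreover have "of_real (- D) - \<alpha> * A = of_real (- (D + cmod A))"
    unfolding \<alpha>(2) by simp
  ultimately have "cmod (of_real (- (D + cmod A))) < cmod B"
    using \<alpha>(1) by (simp only: norm_mult norm_power power_one mult_1_left)
  then have 1: "D + cmod A < cmod B"
    unfolding norm_of_real by linarith
  \<comment> \<open>Index \<open>n - 1\<close> swaps \<open>A\<close> and \<open>B\<close> and has
    the same binomial coefficient as index 1, hence the same \<open>D\<close>.\<close>
  have "n choose (n - 1) = n"
    using n binomial_symmetric[of 1 n] by simp
  then have "cmod (of_real (- D) - B) < cmod A"
    using norm_less_of_Phi_pos[OF p, of n "n - 1" s] pos[of 1 "n - 1"] n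
    by (simp add: A_def B_def D_def algebra_simps)
  moreover have "cmod B - cmod (of_real (- D)) \<le> cmod (of_real (- D) - B)"
    by (metis norm_minus_commute norm_triangle_ineq2)
  moreover have "cmod (of_real (- D)) = D"
    using p unfolding norm_of_real by (simp add: D_def)
  ultimately show False
    using 1 by linarith
qed

section \<open>The equivalences\<close>

lemma norm_sum_less_of_mem:
  assumes n: "n \<ge> 2" and mem: "point n s p \<in> symm_polydisc n" and i: "i \<in> {1..n-1}"
  shows "cmod (s i - cnj (s (n - i)) * p) + cmod (s (n - i) - cnj (s i) * p)
      < real (n choose i) * (1 - (cmod p)\<^sup>2)"
proof -
  have p: "cmod p < 1" and Q: "Qpoint n s p \<in> symm_polydisc (n - 1)"
    using Qpoint_mem[OF n mem] by auto
  define d where "d = 1 - (cmod p)\<^sup>2"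
  have d: "d > 0"
    using p by (simp add: d_def abs_square_less_1)
  have i': "n - i \<in> {1..n-1}" "n - (n - i) = i"
    using i by auto
  have norm_Q: "cmod (s j - cnj (s (n - j)) * p) = cmod (Qpoint n s p j) * d" if "j \<in> {1..n-1}" for j
    using that d unfolding Qpoint_def d_def[symmetric] by (simp add: norm_divide)
  \<comment> \<open>Set up for Pascal's rule, with \<open>m choose (n - i)\<close> equal to
    \<open>m choose k\<close> by symmetry.\<close>
  obtain m k where mk: "n = Suc m" "i = Suc k" "k < m"
    using i by (cases n; cases i) auto
  have "((n - 1) choose i) + ((n - 1) choose (n - i)) = n choose i"
    using mk binomial_symmetric[of k m] by simp
  then have "cmod (Qpoint n s p i) + cmod (Qpoint n s p (n - i)) < real (n choose i)"
    using symm_polydisc_coord_less[OF Q i] symm_polydisc_coord_less[OF Q i'(1)] by linarith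
  then have "(cmod (Qpoint n s p i) + cmod (Qpoint n s p (n - i))) * d < real (n choose i) * d"
    using d by simp
  then show ?thesis
    using norm_Q[OF i] norm_Q[OF i'(1)] unfolding i'(2) by (simp add: d_def[symmetric] distrib_right)
qed

lemma point_scale_mem:
  assumes "point n s p \<in> symm_polydisc n" "cmod \<alpha> \<le> 1"
  shows "point n (\<lambda>j. \<alpha> ^ j * s j) (\<alpha> ^ n * p) \<in> symm_polydisc n"
proof -
  have "(\<lambda>k\<in>{1..n}. \<alpha> ^ k * point n s p k) = point n (\<lambda>j. \<alpha> ^ j * s j) (\<alpha> ^ n * p)"
    by (auto simp: point_def restrict_def)
  then show ?thesis
    using symm_polydisc_scale[OF assms] by simp
qed

theorem theorem3p1:
  fixes n :: nat and s :: "nat \<Rightarrow> complex" and p :: complex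
  assumes "n \<ge> 2"
  shows
    "(point n s p \<in> symm_polydisc n \<longleftrightarrow>
        (\<forall>\<omega>\<in>sphere 0 1. point n (\<lambda>i. \<omega> ^ i * s i) (\<omega> ^ n * p) \<in> symm_polydisc n)) \<and>
     (point n s p \<in> symm_polydisc n \<longleftrightarrow>
        (\<forall>\<alpha>\<in>cball 0 1. \<forall>i\<in>{1..n-1}. Phi n i (\<lambda>j. \<alpha> ^ j * s j) (\<alpha> ^ n * p) > 0) \<and>
        cmod p \<noteq> 1 \<and> Qpoint n s p \<in> symm_polydisc (n - 1)) \<and>
     (point n s p \<in> symm_polydisc n \<longleftrightarrow>
        (\<forall>\<alpha>\<in>cball 0 1. \<forall>i\<in>{1..n-1}.
           cmod (of_nat (n choose i) * \<alpha> ^ n * p - \<alpha> ^ (n - i) * s (n - i))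
             < cmod (of_nat (n choose i) - \<alpha> ^ i * s i)) \<and>
        cmod p \<noteq> 1 \<and> Qpoint n s p \<in> symm_polydisc (n - 1)) \<and>
     (point n s p \<in> symm_polydisc n \<longleftrightarrow>
        (\<forall>i\<in>{1..n-1}.
           cmod (s i - cnj (s (n - i)) * p) + cmod (s (n - i) - cnj (s i) * p)
             < real (n choose i) * (1 - cmod p ^ 2)) \<and>
        cmod p \<noteq> 1 \<and> Qpoint n s p \<in> symm_polydisc (n - 1)) \<and>
     (point n s p \<in> symm_polydisc n \<longleftrightarrow>
        cmod p < 1 \<and>
        (\<exists>c\<in>symm_polydisc (n - 1). \<forall>i\<in>{1..n-1}. s i = c i + cnj (c (n - i)) * p))"
proof -
  note n = \<open>n \<ge> 2\<close>
  let ?M = "point n s p \<in> symm_polydisc n"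
  let ?Q = "cmod p \<noteq> 1 \<and> Qpoint n s p \<in> symm_polydisc (n - 1)"
  let ?Phi = "\<forall>\<alpha>\<in>cball 0 1. \<forall>i\<in>{1..n-1}. Phi n i (\<lambda>j. \<alpha> ^ j * s j) (\<alpha> ^ n * p) > 0"
  \<comment> \<open>In this form a condition containing \<open>?Q\<close> yields \<open>?M\<close>
    once it gives \<open>cmod p < 1\<close>.\<close>
  have M_iff: "?M \<longleftrightarrow> cmod p < 1 \<and> ?Q"
    using point_mem_iff_Qpoint[OF n] by auto
  have rotation: "?M \<longleftrightarrow>
      (\<forall>\<omega>\<in>sphere 0 1. point n (\<lambda>i. \<omega> ^ i * s i) (\<omega> ^ n * p) \<in> symm_polydisc n)"
  proof
    assume "\<forall>\<omega>\<in>sphere 0 1. point n (\<lambda>i. \<omega> ^ i * s i) (\<omega> ^ n * p) \<in> symm_polydisc n"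
    from bspec[OF this, of 1] show ?M
      by simp
  qed (auto intro: point_scale_mem)
  have Phi: "?M \<longleftrightarrow> ?Phi \<and> ?Q"
  proof
    assume M: ?M
    \<comment> \<open>The estimate is applied to the scaled point, which stays in the symmetrized
      polydisc.\<close>
    have "Phi n i (\<lambda>j. \<alpha> ^ j * s j) (\<alpha> ^ n * p) > 0"
      if "cmod \<alpha> \<le> 1" "i \<in> {1..n-1}" for \<alpha> i
    proof -
      have mem: "point n (\<lambda>j. \<alpha> ^ j * s j) (\<alpha> ^ n * p) \<in> symm_polydisc n"
        using M that(1) by (rule point_scale_mem)
      show ?thesis
        by (rule Phi_pos_of_norm_sum_less)
           (rule Qpoint_mem(1)[OF n mem], rule norm_sum_less_of_mem[OF n mem that(2)])
    qed
    then show "?Phi \<and> ?Q"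
      using M M_iff by simp
  next
    assume R: "?Phi \<and> ?Q"
    then have "cmod p < 1"
      using norm_less_one_of_Phi_pos[OF n, of p s] by simp
    then show ?M
      using R M_iff by blast
  qed
  have norms: "?M \<longleftrightarrow> (\<forall>\<alpha>\<in>cball 0 1. \<forall>i\<in>{1..n-1}.
           cmod (of_nat (n choose i) * \<alpha> ^ n * p - \<alpha> ^ (n - i) * s (n - i))
             < cmod (of_nat (n choose i) - \<alpha> ^ i * s i)) \<and> ?Q"
    using Phi unfolding Phi_pos_iff by (simp only: mult.assoc)
  have sums: "?M \<longleftrightarrow> (\<forall>i\<in>{1..n-1}.
           cmod (s i - cnj (s (n - i)) * p) + cmod (s (n - i) - cnj (s i) * p)
             < real (n choose i) * (1 - cmod p ^ 2)) \<and> ?Q"  (is "_ \<longleftrightarrow> ?S \<and> ?Q")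
  proof
    assume M: ?M
    then show "?S \<and> ?Q"
      using norm_sum_less_of_mem[OF n M] M_iff by blast
  next
    assume R: "?S \<and> ?Q"
    \<comment> \<open>Index 1 exists as \<open>n \<ge> 2\<close>; the nonnegative left side forces
      \<open>cmod p < 1\<close>.\<close>
    have "cmod (s 1 - cnj (s (n - 1)) * p) + cmod (s (n - 1) - cnj (s 1) * p)
        < real (n choose 1) * (1 - cmod p ^ 2)"
      using bspec[OF conjunct1[OF R], of 1] n by simp
    moreover have "0 \<le> cmod (s 1 - cnj (s (n - 1)) * p) + cmod (s (n - 1) - cnj (s 1) * p)"
      by simp
    ultimately have "0 < real (n choose 1) * (1 - cmod p ^ 2)"
      by linarith
    then have "cmod p < 1"
      by (simp add: zero_less_mult_iff abs_square_less_1)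
    then show ?M
      using R M_iff by blast
  qed
  have decomposition: "?M \<longleftrightarrow> cmod p < 1 \<and>
        (\<exists>c\<in>symm_polydisc (n - 1). \<forall>i\<in>{1..n-1}. s i = c i + cnj (c (n - i)) * p)"
    using point_mem_iff_Qpoint[OF n] Qpoint_decomposition
      point_symm_polydisc_of_decomposition[OF n] by blast
  show ?thesis
    by (intro conjI) (fact rotation Phi norms sums decomposition)+
qed

end
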